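(* Consider the three-location pursuit gambling game with parameter sets $I,J$ (described in the context), and its $\lambda$-discounted values $v_\lambda$. 1) If $I=J=[0,1/4]$, then $v_\lambda$ converges as $\lambda\to0$ to the function $v$ given by $v(a,a')=v(a,b')=v(b,a')=v(b,b')=\tfrac12$, $v(a,c')=v(b,c')=1$, $v(c,a')=v(c,b')=v(c,c')=0$. 2) If $J=[0,1/4]$ and $I=\{0,1/4\}$, then $v_\lambda$ converges as $\lambda\to0$ to the function $v$ given by $v(a,a')=v(a,b')=v(b,a')=v(b,b')=0$, $v(a,c')=v(b,c')=1$, $v(c,a')=v(c,b')=v(c,c')=0$. 3) If $J=[0,1/4]$ and $I=\{4^{-n}: n\in\mathbb N,\ n\ge1\}\cup\{0\}$, then $v_\lambda$ does not converge as $\lambda\to0$.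
   Context: The three-location pursuit gambling game with compact parameter sets $I,J\subset[0,1/2]$, $0\in I\cap J$: the state space of Player 1 is $X=\{a,b,c\}$, that of Player 2 is $Y=\{a',b',c'\}$. Transitions of Player 1 (subsets of $\Delta(X)$, the probabilities on $X$): $\Gamma(c)=\{\delta_c\}$, $\Gamma(a)=\operatorname{conv}\{(1-\alpha-\alpha^2)\delta_a+\alpha\delta_b+\alpha^2\delta_c:\alpha\in I\}$, $\Gamma(b)=\operatorname{conv}\{(1-\alpha-\alpha^2)\delta_b+\alpha\delta_a+\alpha^2\delta_c:\alpha\in I\}$. Transitions $\Lambda$ of Player 2 are the same with $a',b',c'$ in place of $a,b,c$ and $J$ in place of $I$. The payoff is $u(a,a')=u(b,b')=u(c,c')=0$ and $u=1$ at all other pairs in $X\times Y$. For $\lambda\in(0,1]$, $v_\lambda:X\times Y\to\mathbb R$ is the unique function such that for all $(x,y)$: $v_\lambda(x,y)=\max_{p\in\Gamma(x)}\min_{q\in\Lambda(y)}(\lambda u(x,y)+(1-\lambda)\tilde v_\lambda(p,q))=\min_{q\in\Lambda(y)}\max_{p\in\Gamma(x)}(\lambda u(x,y)+(1-\lambda)\tilde v_\lambda(p,q))$, where $\tilde v_\lambda(p,q)=\sum_{x,y}p(x)q(y)v_\lambda(x,y)$. *)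

theory Defs
  imports "HOL-Analysis.Analysis"
begin

text \<open>The three-location pursuit gambling game. The locations of both players are modelled by
  the same type, so that \<open>loc_a\<close> stands for $a$ as well as for $a'$, and similarly for the others.\<close>

datatype loc = loc_a | loc_b | loc_c

instance loc :: finite
proof
  have "(UNIV :: loc set) = {loc_a, loc_b, loc_c}"
    using loc.exhaust by blast
  then show "finite (UNIV :: loc set)"
    by (metis finite.emptyI finite.insertI)
qed

text \<open>A probability on locations is the vector of its weights.\<close>

definition dirac :: "loc \<Rightarrow> real ^ loc" where
  "dirac x = axis x 1"

fun transitions :: "real set \<Rightarrow> loc \<Rightarrow> (real ^ loc) set" where
  "transitions S loc_a = convex hull
     ((\<lambda>\<alpha>. (1 - \<alpha> - \<alpha>\<^sup>2) *\<^sub>R dirac loc_a + \<alpha> *\<^sub>R dirac loc_b + \<alpha>\<^sup>2 *\<^sub>R dirac loc_c) ` S)"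
| "transitions S loc_b = convex hull
     ((\<lambda>\<alpha>. (1 - \<alpha> - \<alpha>\<^sup>2) *\<^sub>R dirac loc_b + \<alpha> *\<^sub>R dirac loc_a + \<alpha>\<^sup>2 *\<^sub>R dirac loc_c) ` S)"
| "transitions S loc_c = {dirac loc_c}"

definition payoff :: "loc \<Rightarrow> loc \<Rightarrow> real" where
  "payoff x y = (if x = y then 0 else 1)"

definition lin_ext :: "(loc \<Rightarrow> loc \<Rightarrow> real) \<Rightarrow> real ^ loc \<Rightarrow> real ^ loc \<Rightarrow> real" where
  "lin_ext v p q = (\<Sum>x\<in>UNIV. \<Sum>y\<in>UNIV. p $ x * q $ y * v x y)"

text \<open>Attained maxima and minima over possibly infinite sets. For compact parameter sets all the
  extrema occurring below are attained.\<close>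

definition max_over :: "'a set \<Rightarrow> ('a \<Rightarrow> real) \<Rightarrow> real" where
  "max_over S f = (GREATEST r. r \<in> f ` S)"

definition min_over :: "'a set \<Rightarrow> ('a \<Rightarrow> real) \<Rightarrow> real" where
  "min_over S f = (LEAST r. r \<in> f ` S)"

definition shapley_eq :: "real set \<Rightarrow> real set \<Rightarrow> real \<Rightarrow> (loc \<Rightarrow> loc \<Rightarrow> real) \<Rightarrow> bool" where
  "shapley_eq I J l v \<longleftrightarrow> (\<forall>x y.
     v x y = max_over (transitions I x) (\<lambda>p. min_over (transitions J y)
               (\<lambda>q. l * payoff x y + (1 - l) * lin_ext v p q)) \<and>
     v x y = min_over (transitions J y) (\<lambda>q. max_over (transitions I x)
               (\<lambda>p. l * payoff x y + (1 - l) * lin_ext v p q)))"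

text \<open>The discounted value; only meaningful for discount factors \<open>l\<close> in $(0,1]$.\<close>

definition disc_value :: "real set \<Rightarrow> real set \<Rightarrow> real \<Rightarrow> loc \<Rightarrow> loc \<Rightarrow> real" where
  "disc_value I J l = (THE v. shapley_eq I J l v)"

text \<open>The limit functions, with \<open>r\<close> the common value at the four pairs in which neither player
  is at location $c$.\<close>

fun limit_fun :: "real \<Rightarrow> loc \<Rightarrow> loc \<Rightarrow> real" where
  "limit_fun r loc_c y = 0"
| "limit_fun r x loc_c = 1"
| "limit_fun r x y = r"

end

theory Submission
  imports Defs
begin

text \<open>
  The extrema in \<open>shapley_eq\<close> range over convex hulls, but every value that matters can be read
  off from a saddle point at generating moves. Against a fixed move of the opponent the expected
  value is affine, so a saddle inequality needs to be checked at the generators only; and a function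
  with such a saddle at every pair of locations is the unique solution, since the distance to any
  other solution shrinks by the factor \<open>1 - l\<close> (\<open>disc_value_eq_if_local_saddles\<close>).

  Assume that the parameters of Player 1 form a compact set \<open>I\<close> and those of Player 2 the interval
  \<open>[0, 1/4]\<close>. Let \<open>x\<close> be the value when the players are together in \<open>{a, b}\<close>, \<open>y\<close> the value
  when they are apart there, and \<open>w\<close> the value when only Player 1 is at \<open>c\<close>. For small \<open>l\<close> one
  has \<open>x \<le> y\<close>: Player 2 stays put when together and Player 1 stays put when apart. The other
  player then solves a one-parameter optimization. With \<open>r\<^sup>2 = l / (1 - l)\<close> the two equations
  become

    \<open>r\<^sup>2 x = max {a (y - x) - a\<^sup>2 (x - w) | a \<in> I}\<close>, \<open>r\<^sup>2 (1 - y) = max {b (y - x) - b\<^sup>2 (1 - y) | b \<in> [0, 1/4]}\<close>.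

  A solution exists by Brouwer's theorem (\<open>reduced_solution_exists\<close>). In the second equation the
  maximum is at \<open>b = r\<close>, which gives \<open>y - x = 2 r (1 - y)\<close> (\<open>separation_gain\<close>). Up to terms of
  order \<open>r\<close>, the first equation then says \<open>x = max {2 k (1 - x) - k\<^sup>2 x | k r \<in> I}\<close>, that is,
  \<open>x = max {2 k / (1 + k)\<^sup>2 | k r \<in> I}\<close>. The limit is decided by how closely \<open>I\<close> approximates
  \<open>r\<close>. If \<open>r \<in> I\<close>, then \<open>k = 1\<close> gives \<open>1/2\<close>. If \<open>I = {0, 1/4}\<close>, then \<open>k\<close> is \<open>0\<close> or of order
  \<open>1/r\<close>, and \<open>x\<close> tends to \<open>0\<close>. If \<open>I\<close> consists of \<open>0\<close> and the positive powers of \<open>1/4\<close>, then \<open>k = 1\<close>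
  is available along \<open>r = (1/4)\<^sup>n\<close>, whereas along \<open>r = 2 (1/4)\<^sup>n\<close> the best choices are
  \<open>k = 1/2\<close> and \<open>k = 2\<close>, which give \<open>4/9\<close>; so there is no limit.
\<close>

section \<open>Attained extrema\<close>

lemma max_over_eqI:
  assumes "s \<in> S" "\<And>t. t \<in> S \<Longrightarrow> f t \<le> f s"
  shows "max_over S f = f s"
  unfolding max_over_def using assms by (intro Greatest_equality) auto

lemma min_over_eqI:
  assumes "s \<in> S" "\<And>t. t \<in> S \<Longrightarrow> f s \<le> f t"
  shows "min_over S f = f s"
  unfolding min_over_def using assms by (intro Least_equality) auto

lemma max_over_attained:
  assumes "compact S" "S \<noteq> {}" "continuous_on S f"
  shows "\<exists>s\<in>S. max_over S f = f s"
    and "t \<in> S \<Longrightarrow> f t \<le> max_over S f"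
proof -
  obtain s where s: "s \<in> S" "\<And>t. t \<in> S \<Longrightarrow> f t \<le> f s"
    using continuous_attains_sup[OF assms] by blast
  then have "max_over S f = f s" by (rule max_over_eqI)
  with s show "\<exists>s\<in>S. max_over S f = f s" "t \<in> S \<Longrightarrow> f t \<le> max_over S f" by auto
qed

lemma min_over_attained:
  assumes "compact S" "S \<noteq> {}" "continuous_on S f"
  shows "\<exists>s\<in>S. min_over S f = f s"
    and "t \<in> S \<Longrightarrow> min_over S f \<le> f t"
proof -
  obtain s where s: "s \<in> S" "\<And>t. t \<in> S \<Longrightarrow> f s \<le> f t"
    using continuous_attains_inf[OF assms] by blast
  then have "min_over S f = f s" by (rule min_over_eqI)
  with s show "\<exists>s\<in>S. min_over S f = f s" "t \<in> S \<Longrightarrow> min_over S f \<le> f t" by auto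
qed

text \<open>The inner extremum has to be continuous for the outer one to be attained. Uniform continuity on
  the product moves every \<open>f p q\<close>, and hence the maximum over \<open>q\<close>, by little at once.\<close>

lemma continuous_on_max_over:
  fixes f :: "'a::metric_space \<Rightarrow> 'b::metric_space \<Rightarrow> real"
  assumes P: "compact P" and Q: "compact Q" "Q \<noteq> {}"
    and f: "continuous_on (P \<times> Q) (\<lambda>(p, q). f p q)"
  shows "continuous_on P (\<lambda>p. max_over Q (f p))"
proof -
  have cont: "continuous_on Q (f p)" if "p \<in> P" for p
  proof -
    have "continuous_on Q (\<lambda>q. (\<lambda>(p, q). f p q) (p, q))"
      by (rule continuous_on_compose2[OF f]) (use that in \<open>auto intro!: continuous_intros\<close>)
    then show ?thesis by simp
  qed
  have "uniformly_continuous_on (P \<times> Q) (\<lambda>(p, q). f p q)"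
    using compact_uniformly_continuous[OF f] P Q compact_Times by blast
  note uc = this[unfolded uniformly_continuous_on_def]
  have "uniformly_continuous_on P (\<lambda>p. max_over Q (f p))"
    unfolding uniformly_continuous_on_def
  proof (intro allI impI)
    fix e :: real assume "e > 0"
    then obtain d where d: "d > 0"
      and close: "\<And>z z'. z \<in> P \<times> Q \<Longrightarrow> z' \<in> P \<times> Q \<Longrightarrow> dist z' z < d
        \<Longrightarrow> dist ((\<lambda>(p, q). f p q) z') ((\<lambda>(p, q). f p q) z) < e"
      using uc by metis
    have one_side: "max_over Q (f p') < max_over Q (f p) + e"
      if p: "p \<in> P" "p' \<in> P" "dist p' p < d" for p p'
    proof -
      obtain s where s: "s \<in> Q" "max_over Q (f p') = f p' s"
        using max_over_attained(1)[OF Q cont[OF p(2)]] by blast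
      have "dist (f p' s) (f p s) < e"
        using close[of "(p, s)" "(p', s)"] p s by (simp add: dist_Pair_Pair)
      moreover have "f p s \<le> max_over Q (f p)"
        using max_over_attained(2)[OF Q cont[OF p(1)]] s(1) .
      ultimately show ?thesis using s by (simp add: dist_real_def)
    qed
    have "dist (max_over Q (f p')) (max_over Q (f p)) < e"
      if "p \<in> P" "p' \<in> P" "dist p' p < d" for p p'
      using one_side[of p p'] one_side[of p' p] that by (simp add: dist_real_def dist_commute)
    then show "\<exists>d>0. \<forall>x\<in>P. \<forall>x'\<in>P. dist x' x < d
        \<longrightarrow> dist (max_over Q (f x')) (max_over Q (f x)) < e"
      using d by blast
  qed
  then show ?thesis by (rule uniformly_continuous_imp_continuous)
qed

lemma min_over_uminus:
  assumes "compact Q" "Q \<noteq> {}" "continuous_on Q f"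
  shows "min_over Q f = - max_over Q (\<lambda>q. - f q)"
proof -
  obtain s where s: "s \<in> Q" "min_over Q f = f s"
    using min_over_attained(1)[OF assms] by blast
  then have "max_over Q (\<lambda>q. - f q) = - f s"
    using min_over_attained(2)[OF assms] by (intro max_over_eqI) auto
  with s show ?thesis by simp
qed

lemma continuous_on_min_over:
  fixes f :: "'a::metric_space \<Rightarrow> 'b::metric_space \<Rightarrow> real"
  assumes P: "compact P" and Q: "compact Q" "Q \<noteq> {}"
    and f: "continuous_on (P \<times> Q) (\<lambda>(p, q). f p q)"
  shows "continuous_on P (\<lambda>p. min_over Q (f p))"
proof -
  have "continuous_on (P \<times> Q) (\<lambda>(p, q). - f p q)"
    using continuous_on_minus[OF f] by (simp add: case_prod_unfold)
  then have "continuous_on P (\<lambda>p. - max_over Q (\<lambda>q. - f p q))"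
    by (intro continuous_on_minus continuous_on_max_over[OF P Q])
  moreover have "min_over Q (f p) = - max_over Q (\<lambda>q. - f p q)" if "p \<in> P" for p
  proof (rule min_over_uminus[OF Q])
    have "continuous_on Q (\<lambda>q. (\<lambda>(p, q). f p q) (p, q))"
      by (rule continuous_on_compose2[OF f]) (use that in \<open>auto intro!: continuous_intros\<close>)
    then show "continuous_on Q (f p)" by simp
  qed
  ultimately show ?thesis by (simp cong: continuous_on_cong)
qed

section \<open>Moves and the bilinear extension\<close>

fun mate :: "loc \<Rightarrow> loc" where
  "mate loc_a = loc_b"
| "mate loc_b = loc_a"
| "mate loc_c = loc_c"

text \<open>A generator of the transitions, in one formula for all three locations: as \<open>c\<close> is its own
  mate, every move from \<open>c\<close> is the unit mass at \<open>c\<close>.\<close>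

definition move :: "loc \<Rightarrow> real \<Rightarrow> real ^ loc" where
  "move z \<alpha> = (1 - \<alpha> - \<alpha>\<^sup>2) *\<^sub>R dirac z + \<alpha> *\<^sub>R dirac (mate z) + \<alpha>\<^sup>2 *\<^sub>R dirac loc_c"

lemma transitions_eq_hull_moves:
  assumes "S \<noteq> {}"
  shows "transitions S z = convex hull (move z ` S)"
proof (cases z)
  case loc_c
  have "move loc_c \<alpha> = dirac loc_c" for \<alpha>
    by (simp add: move_def flip: scaleR_add_left)
  then have "move loc_c ` S = {dirac loc_c}" using assms by auto
  with loc_c show ?thesis by simp
qed (simp_all add: move_def)

lemma compact_transitions:
  assumes "compact S" "S \<noteq> {}"
  shows "compact (transitions S z)"
  unfolding transitions_eq_hull_moves[OF assms(2)] move_def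
  by (intro compact_convex_hull compact_continuous_image continuous_intros assms)

lemma move_in_transitions: "\<alpha> \<in> S \<Longrightarrow> move z \<alpha> \<in> transitions S z"
  using transitions_eq_hull_moves[of S z] hull_inc[of "move z \<alpha>" "move z ` S"] by blast

lemma lin_ext_add_left: "lin_ext v (p + p') q = lin_ext v p q + lin_ext v p' q"
  and lin_ext_add_right: "lin_ext v p (q + q') = lin_ext v p q + lin_ext v p q'"
  and lin_ext_scale_left: "lin_ext v (c *\<^sub>R p) q = c * lin_ext v p q"
  and lin_ext_scale_right: "lin_ext v p (c *\<^sub>R q) = c * lin_ext v p q"
  by (simp_all add: lin_ext_def algebra_simps sum.distrib sum_distrib_left)

lemmas lin_ext_bilinear =
  lin_ext_add_left lin_ext_add_right lin_ext_scale_left lin_ext_scale_right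

lemma lin_ext_dirac: "lin_ext v (dirac z) (dirac z') = v z z'"
proof -
  have "dirac z $ x * dirac z' $ y * v x y
      = (if y = z' then (if x = z then v x y else 0) else 0)" for x y
    by (simp add: dirac_def axis_def)
  then show ?thesis by (simp add: lin_ext_def)
qed

lemma continuous_on_lin_ext: "continuous_on S (\<lambda>(p, q). lin_ext v p q)"
  unfolding lin_ext_def case_prod_unfold by (intro continuous_intros)

lemma continuous_on_lin_ext_left: "continuous_on S (\<lambda>p. lin_ext v p q)"
  and continuous_on_lin_ext_right: "continuous_on S (\<lambda>q. lin_ext v p q)"
  unfolding lin_ext_def by (intro continuous_intros)+

lemma lin_ext_transitions_le:
  assumes "p \<in> transitions S z" "S \<noteq> {}" "\<And>\<alpha>. \<alpha> \<in> S \<Longrightarrow> lin_ext v (move z \<alpha>) q \<le> V"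
  shows "lin_ext v p q \<le> V"
proof -
  have "convex {p. lin_ext v p q \<le> V}"
    by (rule convexI) (auto simp: lin_ext_bilinear intro: convex_bound_le)
  then have "convex hull (move z ` S) \<subseteq> {p. lin_ext v p q \<le> V}"
    using assms(3) by (intro hull_minimal) auto
  with assms show ?thesis by (auto simp: transitions_eq_hull_moves)
qed

lemma lin_ext_transitions_ge:
  assumes "q \<in> transitions S z" "S \<noteq> {}" "\<And>\<beta>. \<beta> \<in> S \<Longrightarrow> V \<le> lin_ext v p (move z \<beta>)"
  shows "V \<le> lin_ext v p q"
proof -
  have "convex {q. V \<le> lin_ext v p q}"
  proof (rule convexI)
    fix q q' and s t :: real
    assume "q \<in> {q. V \<le> lin_ext v p q}" "q' \<in> {q. V \<le> lin_ext v p q}" "0 \<le> s" "0 \<le> t" "s + t = 1"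
    then show "s *\<^sub>R q + t *\<^sub>R q' \<in> {q. V \<le> lin_ext v p q}"
      using convex_bound_le[of "- lin_ext v p q" "- V" "- lin_ext v p q'" s t]
      by (simp add: lin_ext_bilinear)
  qed
  then have "convex hull (move z ` S) \<subseteq> {q. V \<le> lin_ext v p q}"
    using assms(3) by (intro hull_minimal) auto
  with assms show ?thesis by (auto simp: transitions_eq_hull_moves)
qed

text \<open>All elements of \<open>transitions S z\<close> are probability vectors, because \<open>1 - \<alpha> - \<alpha>\<^sup>2 \<ge> 0\<close> for the
  parameters allowed here. So \<open>lin_ext\<close> averages, and cannot enlarge a uniform difference.\<close>

lemma lin_ext_diff_bound:
  assumes p: "p \<in> transitions S z" "S \<noteq> {}" "S \<subseteq> {0..1/4}"
    and q: "q \<in> transitions T z'" "T \<noteq> {}" "T \<subseteq> {0..1/4}"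
    and d: "\<And>x y. v x y \<le> w x y + d"
  shows "lin_ext v p q \<le> lin_ext w p q + d"
proof -
  have dist: "(\<forall>x. 0 \<le> p $ x) \<and> (\<Sum>x\<in>UNIV. p $ x) = 1"
    if "p \<in> transitions S z" "S \<noteq> {}" "S \<subseteq> {0..1/4}" for p z and S :: "real set"
  proof -
    have "move z \<alpha> \<in> {p. (\<forall>x. 0 \<le> p $ x) \<and> (\<Sum>x\<in>UNIV. p $ x) = 1}" if "\<alpha> \<in> {0..1/4}" for \<alpha>
    proof -
      have "\<alpha>\<^sup>2 \<le> (1/4)\<^sup>2" using that by (intro power_mono) auto
      with that have "0 \<le> 1 - \<alpha> - \<alpha>\<^sup>2" by (simp add: power2_eq_square)
      moreover have "(\<Sum>x\<in>UNIV. dirac z $ x) = 1" for z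
        by (simp add: dirac_def axis_def)
      ultimately show ?thesis using that
        by (simp add: move_def sum.distrib flip: sum_distrib_left)
          (simp add: dirac_def axis_def)
    qed
    moreover have "convex {p :: real ^ loc. (\<forall>x. 0 \<le> p $ x) \<and> (\<Sum>x\<in>UNIV. p $ x) = 1}"
      by (rule convexI) (simp add: sum.distrib flip: sum_distrib_left)
    ultimately have "convex hull (move z ` S) \<subseteq> {p. (\<forall>x. 0 \<le> p $ x) \<and> (\<Sum>x\<in>UNIV. p $ x) = 1}"
      using that(3) by (intro hull_minimal) auto
    with that show ?thesis by (auto simp: transitions_eq_hull_moves)
  qed
  note P = dist[OF p] and Q = dist[OF q]
  have "lin_ext v p q \<le> (\<Sum>x\<in>UNIV. \<Sum>y\<in>UNIV. p $ x * q $ y * (w x y + d))"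
    unfolding lin_ext_def using P Q d by (intro sum_mono mult_left_mono) auto
  also have "\<dots> = lin_ext w p q + (\<Sum>x\<in>UNIV. p $ x * (\<Sum>y\<in>UNIV. q $ y)) * d"
    by (simp add: lin_ext_def algebra_simps sum.distrib sum_distrib_left sum_distrib_right)
  also have "\<dots> = lin_ext w p q + d" using P Q by simp
  finally show ?thesis .
qed

section \<open>Saddle points determine the discounted value\<close>

text \<open>The saddle point property of \<open>(\<alpha>, \<beta>)\<close> is required against generating moves only;
  \<open>local_saddle_transitions\<close> extends it to their convex hulls.\<close>

definition local_saddle :: "real set \<Rightarrow> real set \<Rightarrow> real \<Rightarrow> (loc \<Rightarrow> loc \<Rightarrow> real) \<Rightarrow> loc \<Rightarrow> loc
    \<Rightarrow> real \<Rightarrow> real \<Rightarrow> bool" where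
  "local_saddle I J l v x y \<alpha> \<beta> \<longleftrightarrow> \<alpha> \<in> I \<and> \<beta> \<in> J \<and>
     (\<forall>\<alpha>'\<in>I. l * payoff x y + (1 - l) * lin_ext v (move x \<alpha>') (move y \<beta>) \<le> v x y) \<and>
     (\<forall>\<beta>'\<in>J. v x y \<le> l * payoff x y + (1 - l) * lin_ext v (move x \<alpha>) (move y \<beta>'))"

lemma local_saddle_transitions:
  assumes "local_saddle I J l v x y \<alpha> \<beta>" "l < 1"
  shows "p \<in> transitions I x \<Longrightarrow> l * payoff x y + (1 - l) * lin_ext v p (move y \<beta>) \<le> v x y"
    and "q \<in> transitions J y \<Longrightarrow> v x y \<le> l * payoff x y + (1 - l) * lin_ext v (move x \<alpha>) q"
proof -
  note s = assms(1)[unfolded local_saddle_def]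
  have l: "0 < 1 - l" using assms by simp
  define V where "V = (v x y - l * payoff x y) / (1 - l)"
  have le: "l * payoff x y + (1 - l) * t \<le> v x y \<longleftrightarrow> t \<le> V"
   and ge: "v x y \<le> l * payoff x y + (1 - l) * t \<longleftrightarrow> V \<le> t" for t
    using l unfolding V_def by (auto simp: field_simps)
  show "l * payoff x y + (1 - l) * lin_ext v p (move y \<beta>) \<le> v x y" if "p \<in> transitions I x"
    unfolding le by (rule lin_ext_transitions_le[OF that]) (use s in \<open>auto simp: le\<close>)
  show "v x y \<le> l * payoff x y + (1 - l) * lin_ext v (move x \<alpha>) q" if "q \<in> transitions J y"
    unfolding ge by (rule lin_ext_transitions_ge[OF that]) (use s in \<open>auto simp: ge\<close>)
qed

lemma shapley_eq_if_local_saddles: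
  assumes "compact I" "compact J" "l < 1"
    and "\<And>x y. \<exists>\<alpha> \<beta>. local_saddle I J l v x y \<alpha> \<beta>"
  shows "shapley_eq I J l v"
  unfolding shapley_eq_def
proof (intro allI)
  fix x y
  let ?f = "\<lambda>p q. l * payoff x y + (1 - l) * lin_ext v p q"
  let ?P = "transitions I x" and ?Q = "transitions J y"
  obtain \<alpha> \<beta> where s: "local_saddle I J l v x y \<alpha> \<beta>" using assms(4) by blast
  then have mem: "\<alpha> \<in> I" "\<beta> \<in> J" by (auto simp: local_saddle_def)
  note P = local_saddle_transitions(1)[OF s \<open>l < 1\<close>]
    and Q = local_saddle_transitions(2)[OF s \<open>l < 1\<close>]
  have p: "move x \<alpha> \<in> ?P" and q: "move y \<beta> \<in> ?Q" using mem move_in_transitions by auto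
  have cP: "compact ?P" "?P \<noteq> {}" and cQ: "compact ?Q" "?Q \<noteq> {}"
    using compact_transitions assms mem p q by blast+
  have pq: "?f (move x \<alpha>) (move y \<beta>) = v x y"
    using P[OF p] Q[OF q] by linarith
  have minv: "min_over ?Q (?f (move x \<alpha>)) = v x y"
    using min_over_eqI[of "move y \<beta>" ?Q "?f (move x \<alpha>)"] Q q pq by auto
  have maxv: "max_over ?P (\<lambda>p. ?f p (move y \<beta>)) = v x y"
    using max_over_eqI[of "move x \<alpha>" ?P "\<lambda>p. ?f p (move y \<beta>)"] P p pq by auto
  have "min_over ?Q (?f p) \<le> v x y" if "p \<in> ?P" for p
  proof -
    have "continuous_on ?Q (?f p)" by (intro continuous_intros continuous_on_lin_ext_right)
    from min_over_attained(2)[OF cQ this q]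
    have "min_over ?Q (?f p) \<le> ?f p (move y \<beta>)" .
    with P[OF that] show ?thesis by linarith
  qed
  then have "max_over ?P (\<lambda>p. min_over ?Q (?f p)) = min_over ?Q (?f (move x \<alpha>))"
    by (intro max_over_eqI[OF p]) (simp add: minv)
  moreover have "v x y \<le> max_over ?P (\<lambda>p. ?f p q)" if "q \<in> ?Q" for q
  proof -
    have "continuous_on ?P (\<lambda>p. ?f p q)" by (intro continuous_intros continuous_on_lin_ext_left)
    from max_over_attained(2)[OF cP this p]
    have "?f (move x \<alpha>) q \<le> max_over ?P (\<lambda>p. ?f p q)" .
    with Q[OF that] show ?thesis by linarith
  qed
  then have "min_over ?Q (\<lambda>q. max_over ?P (\<lambda>p. ?f p q)) = max_over ?P (\<lambda>p. ?f p (move y \<beta>))"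
    by (intro min_over_eqI[OF q]) (simp add: maxv)
  ultimately show "v x y = max_over ?P (\<lambda>p. min_over ?Q (?f p)) \<and>
      v x y = min_over ?Q (\<lambda>q. max_over ?P (\<lambda>p. ?f p q))"
    using minv maxv by simp
qed

text \<open>Either player has a reply to a given choice of the opponent that does at least as well as the
  value: the optimal reply, since the value is the extremum over the opponent's choices.\<close>

lemma shapley_eq_optimal_choices:
  assumes "shapley_eq I J l w" "compact I" "I \<noteq> {}" "compact J" "J \<noteq> {}"
    and p: "p \<in> transitions I x" and q: "q \<in> transitions J y"
  obtains p' q' where "p' \<in> transitions I x" "q' \<in> transitions J y"
    "l * payoff x y + (1 - l) * lin_ext w p q' \<le> w x y"
    "w x y \<le> l * payoff x y + (1 - l) * lin_ext w p' q"
proof -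
  let ?f = "\<lambda>p q. l * payoff x y + (1 - l) * lin_ext w p q"
  let ?P = "transitions I x" and ?Q = "transitions J y"
  have cP: "compact ?P" "?P \<noteq> {}" and cQ: "compact ?Q" "?Q \<noteq> {}"
    using compact_transitions assms by blast+
  have joint: "continuous_on (?P \<times> ?Q) (\<lambda>(p, q). ?f p q)"
    using continuous_on_lin_ext[of "?P \<times> ?Q" w] unfolding case_prod_unfold
    by (intro continuous_intros)
  have "continuous_on (?Q \<times> ?P) (\<lambda>(q, p). ?f p q)"
    using continuous_on_compose2[OF joint continuous_on_swap, of "?Q \<times> ?P"]
    by (simp add: case_prod_unfold product_swap)
  note outer_max = max_over_attained(2)[OF cP continuous_on_min_over[OF cP(1) cQ joint] p]
    and outer_min = min_over_attained(2)[OF cQ continuous_on_max_over[OF cQ(1) cP this] q]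
  have "continuous_on ?Q (?f p)" by (intro continuous_intros continuous_on_lin_ext_right)
  then obtain q' where q': "q' \<in> ?Q" "min_over ?Q (?f p) = ?f p q'"
    using min_over_attained(1)[OF cQ] by blast
  have "continuous_on ?P (\<lambda>p. ?f p q)" by (intro continuous_intros continuous_on_lin_ext_left)
  then obtain p' where p': "p' \<in> ?P" "max_over ?P (\<lambda>p. ?f p q) = ?f p' q"
    using max_over_attained(1)[OF cP] by blast
  have "w x y = max_over ?P (\<lambda>p. min_over ?Q (?f p))"
    and "w x y = min_over ?Q (\<lambda>q. max_over ?P (\<lambda>p. ?f p q))"
    using assms(1) unfolding shapley_eq_def by blast+
  then have "?f p q' \<le> w x y" "w x y \<le> ?f p' q"
    using outer_max outer_min unfolding p'(2) q'(2) by simp_all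
  then show ?thesis using that p'(1) q'(1) by blast
qed

text \<open>Uniqueness: let \<open>w\<close> be another solution and \<open>d\<close> its maximal distance from \<open>v\<close>, attained at
  \<open>(x, y)\<close>. Pairing the saddle choice of one player for \<open>v\<close> with the reply of the other for \<open>w\<close>
  compares \<open>v x y\<close> with \<open>w x y\<close> through a common pair of transitions, so that \<open>d \<le> (1 - l) d\<close>.\<close>

theorem disc_value_eq_if_local_saddles:
  assumes "compact I" "I \<subseteq> {0..1/4}" "compact J" "J \<subseteq> {0..1/4}" "0 < l" "l < 1"
    and saddles: "\<And>x y. \<exists>\<alpha> \<beta>. local_saddle I J l v x y \<alpha> \<beta>"
  shows "disc_value I J l = v"
  unfolding disc_value_def
proof (rule the_equality)
  show "shapley_eq I J l v" using shapley_eq_if_local_saddles assms by blast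
next
  fix w assume w: "shapley_eq I J l w"
  have ne: "I \<noteq> {}" "J \<noteq> {}" using saddles by (auto simp: local_saddle_def)
  define d where "d = Max (range (\<lambda>(x, y). \<bar>w x y - v x y\<bar>))"
  have d: "\<bar>w x y - v x y\<bar> \<le> d" for x y
    unfolding d_def by (rule Max_ge) (auto intro!: rev_image_eqI[of "(x, y)"])
  have "d \<in> range (\<lambda>(x, y). \<bar>w x y - v x y\<bar>)"
    unfolding d_def by (intro Max_in) auto
  then obtain x y where attained: "d = \<bar>w x y - v x y\<bar>" by auto
  obtain \<alpha> \<beta> where s: "local_saddle I J l v x y \<alpha> \<beta>" using saddles by blast
  then have mem: "move x \<alpha> \<in> transitions I x" "move y \<beta> \<in> transitions J y"
    by (auto simp: local_saddle_def move_in_transitions)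
  obtain p' q' where pq': "p' \<in> transitions I x" "q' \<in> transitions J y"
    and lower: "l * payoff x y + (1 - l) * lin_ext w (move x \<alpha>) q' \<le> w x y"
    and upper: "w x y \<le> l * payoff x y + (1 - l) * lin_ext w p' (move y \<beta>)"
    using shapley_eq_optimal_choices[OF w _ _ _ _ mem] assms ne by metis
  have wv: "w x y \<le> v x y + d" and vw: "v x y \<le> w x y + d" for x y
    using d[of x y] by linarith+
  have "(1 - l) * lin_ext v (move x \<alpha>) q' \<le> (1 - l) * (lin_ext w (move x \<alpha>) q' + d)"
    using assms by (intro mult_left_mono lin_ext_diff_bound[OF mem(1) ne(1) _ pq'(2) ne(2) _ vw]) auto
  then have "v x y \<le> w x y + (1 - l) * d"
    using lower local_saddle_transitions(2)[OF s \<open>l < 1\<close> pq'(2)] by (simp add: distrib_left)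
  moreover
  have "(1 - l) * lin_ext w p' (move y \<beta>) \<le> (1 - l) * (lin_ext v p' (move y \<beta>) + d)"
    using assms by (intro mult_left_mono lin_ext_diff_bound[OF pq'(1) ne(1) _ mem(2) ne(2) _ wv]) auto
  then have "w x y \<le> v x y + (1 - l) * d"
    using upper local_saddle_transitions(1)[OF s \<open>l < 1\<close> pq'(1)] by (simp add: distrib_left)
  ultimately have "d \<le> (1 - l) * d" using attained by linarith
  then have "d \<le> 0" using \<open>0 < l\<close> by (simp add: algebra_simps mult_le_0_iff)
  then show "w = v" using d by (intro ext) (smt (verit, best))
qed

section \<open>Reduction to two unknowns\<close>

text \<open>The fixed point of \<open>w = l + (1 - l) (1 - 1/16) w\<close>: alone outside \<open>c\<close>, Player 2 heads for it
  with the largest possible rate, the square of \<open>1/4\<close>.\<close>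

definition chase_value :: "real \<Rightarrow> real" where
  "chase_value l = 16 * l / (1 + 15 * l)"

fun candidate :: "real \<Rightarrow> real \<Rightarrow> real \<Rightarrow> loc \<Rightarrow> loc \<Rightarrow> real" where
  "candidate w x y loc_c loc_c = 0"
| "candidate w x y loc_c _ = w"
| "candidate w x y _ loc_c = 1"
| "candidate w x y z z' = (if z = z' then x else y)"

text \<open>The expected continuation of one player's move with parameter \<open>\<alpha>\<close>, when reaching \<open>c\<close>, staying,
  and changing to the mate location are worth \<open>w\<close>, \<open>x\<close> and \<open>y\<close>.\<close>

definition after_move :: "real \<Rightarrow> real \<Rightarrow> real \<Rightarrow> real \<Rightarrow> real" where
  "after_move w x y \<alpha> = (1 - \<alpha> - \<alpha>\<^sup>2) * x + \<alpha> * y + \<alpha>\<^sup>2 * w"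

text \<open>The optimality equations when only Player 1 moves from a common location and only Player 2
  moves from distinct ones; reaching \<open>c\<close> yields \<open>chase_value l\<close> for Player 1, and \<open>1\<close> for
  Player 2.\<close>

definition reduced_solution :: "real set \<Rightarrow> real \<Rightarrow> real \<Rightarrow> real \<Rightarrow> bool" where
  "reduced_solution I l x y \<longleftrightarrow> x \<in> {0..1} \<and> y \<in> {0..1} \<and>
     x = max_over I (\<lambda>\<alpha>. (1 - l) * after_move (chase_value l) x y \<alpha>) \<and>
     y = min_over {0..1/4} (\<lambda>\<beta>. l + (1 - l) * after_move 1 y x \<beta>)"

lemma chase_value_bounds:
  assumes "0 < l" "l < 1"
  shows "0 \<le> chase_value l" "chase_value l \<le> 1" "chase_value l \<le> 16 * l"
    "chase_value l = l + (1 - l) * (15 / 16) * chase_value l"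
    "chase_value l \<le> 16 * (l / (1 - l))"
  using assms by (auto simp: chase_value_def field_simps)

lemma sq_le_quarter:
  fixes a :: real assumes "a \<in> {0..1/4}" shows "a\<^sup>2 \<le> a / 4" "a\<^sup>2 \<le> 1/16"
  using assms mult_right_mono[of a "1/4" a] by (auto simp: power2_eq_square)

lemma after_move_bounds:
  assumes "a \<in> {0..1/4}" "x \<in> {0..1}" "y \<in> {0..1}" "w \<in> {0..1}"
  shows "0 \<le> after_move w x y a" "after_move w x y a \<le> 1"
proof -
  have c: "0 \<le> 1 - a - a\<^sup>2" using sq_le_quarter[OF assms(1)] assms(1) by auto
  show "0 \<le> after_move w x y a" using c assms by (simp add: after_move_def)
  have "(1 - a - a\<^sup>2) * x \<le> 1 - a - a\<^sup>2" "a * y \<le> a" "a\<^sup>2 * w \<le> a\<^sup>2"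
    using c assms by (auto intro: mult_left_le)
  then show "after_move w x y a \<le> 1" by (simp add: after_move_def)
qed

lemma reduced_solution_exists:
  assumes I: "compact I" "I \<noteq> {}" "I \<subseteq> {0..1/4}" and l: "0 < l" "l < 1"
  shows "\<exists>x y. reduced_solution I l x y"
proof -
  let ?w = "chase_value l" and ?S = "{0..1} \<times> {0..1} :: (real \<times> real) set"
  define F where "F z = max_over I (\<lambda>\<alpha>. (1 - l) * after_move ?w (fst z) (snd z) \<alpha>)" for z
  define G where "G z = min_over {0..1/4} (\<lambda>\<beta>. l + (1 - l) * after_move 1 (snd z) (fst z) \<beta>)" for z
  have S: "compact ?S" "convex ?S" "?S \<noteq> {}"
    by (auto intro: compact_Times convex_Times)
  have "continuous_on ?S F" "continuous_on ?S G"
    unfolding F_def G_def after_move_def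
    by (intro continuous_on_max_over continuous_on_min_over S I;
        auto simp: case_prod_unfold intro!: continuous_intros)+
  then have cont: "continuous_on ?S (\<lambda>z. (F z, G z))" by (intro continuous_intros)
  have "F z \<in> {0..1}" if z: "z \<in> ?S" for z
  proof -
    have "continuous_on I (\<lambda>\<alpha>. (1 - l) * after_move ?w (fst z) (snd z) \<alpha>)"
      unfolding after_move_def by (intro continuous_intros)
    from max_over_attained(1)[OF I(1,2) this] obtain \<alpha>
      where "\<alpha> \<in> I" "F z = (1 - l) * after_move ?w (fst z) (snd z) \<alpha>"
      unfolding F_def by blast
    moreover from this have "after_move ?w (fst z) (snd z) \<alpha> \<in> {0..1}"
      using after_move_bounds[of \<alpha> "fst z" "snd z" ?w] I z chase_value_bounds[OF l] by auto
    ultimately show ?thesis using l by (auto intro: mult_le_one)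
  qed
  moreover have "G z \<in> {0..1}" if z: "z \<in> ?S" for z
  proof -
    have "continuous_on {0..1/4} (\<lambda>\<beta>. l + (1 - l) * after_move 1 (snd z) (fst z) \<beta>)"
      unfolding after_move_def by (intro continuous_intros)
    from min_over_attained(1)[OF _ _ this] obtain \<beta>
      where "\<beta> \<in> {0..1/4}" "G z = l + (1 - l) * after_move 1 (snd z) (fst z) \<beta>"
      unfolding G_def by auto
    moreover from this have "after_move 1 (snd z) (fst z) \<beta> \<in> {0..1}"
      using after_move_bounds[of \<beta> "snd z" "fst z" 1] z by auto
    moreover from this have "(1 - l) * after_move 1 (snd z) (fst z) \<beta> \<le> 1 - l"
      using l by (intro mult_left_le) auto
    moreover from calculation have "0 \<le> (1 - l) * after_move 1 (snd z) (fst z) \<beta>" using l by simp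
    ultimately show ?thesis using l unfolding atLeastAtMost_iff by linarith
  qed
  ultimately have "(\<lambda>z. (F z, G z)) \<in> ?S \<rightarrow> ?S" by auto
  then obtain z where "z \<in> ?S" "(F z, G z) = z"
    using brouwer[OF S cont] by blast
  then have "reduced_solution I l (fst z) (snd z)"
    unfolding reduced_solution_def F_def G_def by (metis fst_conv snd_conv mem_Times_iff)
  then show ?thesis by blast
qed

lemma reduced_solutionD:
  assumes "reduced_solution I l x y" "compact I" "I \<noteq> {}"
  shows "x \<in> {0..1}" "y \<in> {0..1}"
    and "\<exists>\<alpha>\<in>I. x = (1 - l) * after_move (chase_value l) x y \<alpha>"
    and "\<And>\<alpha>. \<alpha> \<in> I \<Longrightarrow> (1 - l) * after_move (chase_value l) x y \<alpha> \<le> x"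
    and "\<exists>\<beta>\<in>{0..1/4}. y = l + (1 - l) * after_move 1 y x \<beta>"
    and "\<And>\<beta>. \<beta> \<in> {0..1/4} \<Longrightarrow> y \<le> l + (1 - l) * after_move 1 y x \<beta>"
proof -
  note R = assms(1)[unfolded reduced_solution_def]
  have cF: "continuous_on I (\<lambda>\<alpha>. (1 - l) * after_move (chase_value l) x y \<alpha>)"
    and cG: "continuous_on {0..1/4} (\<lambda>\<beta>. l + (1 - l) * after_move 1 y x \<beta>)"
    unfolding after_move_def by (intro continuous_intros)+
  show "x \<in> {0..1}" "y \<in> {0..1}" using R by blast+
  show "\<exists>\<alpha>\<in>I. x = (1 - l) * after_move (chase_value l) x y \<alpha>"
    using max_over_attained(1)[OF assms(2,3) cF] R by simp
  show "\<And>\<alpha>. \<alpha> \<in> I \<Longrightarrow> (1 - l) * after_move (chase_value l) x y \<alpha> \<le> x"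
    using max_over_attained(2)[OF assms(2,3) cF] R by simp
  show "\<exists>\<beta>\<in>{0..1/4}. y = l + (1 - l) * after_move 1 y x \<beta>"
    using min_over_attained(1)[OF _ _ cG] R by simp
  show "\<And>\<beta>. \<beta> \<in> {0..1/4} \<Longrightarrow> y \<le> l + (1 - l) * after_move 1 y x \<beta>"
    using min_over_attained(2)[OF _ _ cG] R by simp
qed

text \<open>Player 2 cannot bring \<open>y\<close> below \<open>sqrt l\<close>, because changing location with probability
  \<open>\<beta>\<close> costs \<open>\<beta>\<^sup>2\<close> in lost games, while \<open>chase_value l\<close> is only of order \<open>l\<close>. For larger \<open>l\<close> this
  comparison can fail, and then Player 1 may prefer to leave for \<open>c\<close>. Given it, \<open>x > y\<close> is
  impossible: no move of Player 1 would lift the continuation value above \<open>x\<close>, and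
  discounting would force \<open>x \<le> 0\<close>.\<close>

lemma reduced_solution_order:
  assumes R: "reduced_solution I l x y" and I: "compact I" "I \<noteq> {}" "I \<subseteq> {0..1/4}"
    and l: "0 < l" "l \<le> 1/1024"
  shows "2 * chase_value l \<le> y" "x \<le> y"
proof -
  let ?w = "chase_value l"
  note D = reduced_solutionD[OF R I(1,2)]
  have w: "0 \<le> ?w" "?w \<le> 16 * l" using chase_value_bounds[of l] l by auto
  show "2 * ?w \<le> y"
  proof (cases "1/2 \<le> y")
    case True
    then show ?thesis using w l by simp
  next
    case False
    obtain \<beta> where \<beta>: "\<beta> \<in> {0..1/4}" "y = l + (1 - l) * after_move 1 y x \<beta>" using D(5) by blast
    have "(1 - l) * (y - (\<beta> * y - \<beta>\<^sup>2 * (1 - y))) \<le> (1 - l) * after_move 1 y x \<beta>"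
      using D(1) \<beta>(1) l by (intro mult_left_mono) (auto simp: after_move_def algebra_simps)
    then have le: "l * (1 - y) \<le> (1 - l) * (\<beta> * y - \<beta>\<^sup>2 * (1 - y))"
      using \<beta>(2) by (simp add: algebra_simps)
    moreover have "0 \<le> l * (1 - y)" using l D(2) by simp
    ultimately have "0 \<le> (1 - l) * (\<beta> * y - \<beta>\<^sup>2 * (1 - y))" by linarith
    then have nn: "0 \<le> \<beta> * y - \<beta>\<^sup>2 * (1 - y)"
      using l by (simp add: zero_le_mult_iff)
    then have "(1 - l) * (\<beta> * y - \<beta>\<^sup>2 * (1 - y)) \<le> \<beta> * y - \<beta>\<^sup>2 * (1 - y)"
      using l by (intro mult_left_le_one_le) auto
    with le have "(l + \<beta>\<^sup>2) * (1 - y) \<le> \<beta> * y" by (simp add: algebra_simps)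
    moreover have "(l + \<beta>\<^sup>2) * (1/2) \<le> (l + \<beta>\<^sup>2) * (1 - y)"
      using False l by (intro mult_left_mono) auto
    ultimately have "(l + \<beta>\<^sup>2) * (1/2) \<le> \<beta> * y" by (rule order_trans[rotated])
    then have "l + \<beta>\<^sup>2 \<le> 2 * \<beta> * y" by simp
    also have "\<dots> \<le> \<beta>\<^sup>2 + y\<^sup>2" by (rule sum_squares_bound)
    finally have "l \<le> y\<^sup>2" by simp
    have "32 * l \<le> y"
    proof (rule power2_le_imp_le)
      have "l * l \<le> l * (1/1024)" using l by (intro mult_left_mono) auto
      then have "(32 * l)\<^sup>2 \<le> l" by (simp add: power2_eq_square)
      with \<open>l \<le> y\<^sup>2\<close> show "(32 * l)\<^sup>2 \<le> y\<^sup>2" by simp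
    qed (use D(2) in simp)
    with w show ?thesis by simp
  qed
  show "x \<le> y"
  proof (rule ccontr)
    assume "\<not> x \<le> y"
    then have less: "y < x" "?w \<le> x" using \<open>2 * ?w \<le> y\<close> w by linarith+
    obtain \<alpha> where \<alpha>: "\<alpha> \<in> I" "x = (1 - l) * after_move ?w x y \<alpha>" using D(3) by blast
    have "\<alpha> * y \<le> \<alpha> * x" "\<alpha>\<^sup>2 * ?w \<le> \<alpha>\<^sup>2 * x"
      using \<alpha> I less by (auto intro!: mult_left_mono)
    then have "after_move ?w x y \<alpha> \<le> x" by (simp add: after_move_def algebra_simps)
    then have "(1 - l) * after_move ?w x y \<alpha> \<le> (1 - l) * x"
      using l by (intro mult_left_mono) auto
    with \<alpha>(2) have "x \<le> (1 - l) * x" by linarith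
    then have "l * x \<le> 0" by (simp add: algebra_simps)
    with l have "x \<le> 0" by (simp add: mult_le_0_iff)
    with less D(2) show False by auto
  qed
qed

lemma lin_ext_move:
  "lin_ext v (move z \<alpha>) (move z' \<beta>) =
     after_move
       (after_move (v loc_c loc_c) (v loc_c z') (v loc_c (mate z')) \<beta>)
       (after_move (v z loc_c) (v z z') (v z (mate z')) \<beta>)
       (after_move (v (mate z) loc_c) (v (mate z) z') (v (mate z) (mate z')) \<beta>) \<alpha>"
  unfolding move_def after_move_def lin_ext_bilinear lin_ext_dirac by (simp add: algebra_simps)

lemma after_move_const: "after_move c c c a = c" by (simp add: after_move_def algebra_simps)

lemma after_move_0: "after_move w x y 0 = x" by (simp add: after_move_def)

text \<open>When the players are together, a change of location by Player 2 separates them and a jump to \<open>c\<close>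
  gives the game away. With \<open>A\<close>, \<open>B\<close>, \<open>C\<close> the continuation values of staying, changing and jumping,
  averaged over the optimal move of Player 1, this is \<open>A \<le> B\<close> and \<open>A \<le> C\<close>. The second inequality is
  the delicate one, as Player 1 may arrive at \<open>c\<close> as well; it uses that \<open>1 - x\<close> is at least of the
  order of the probability of this.\<close>

lemma pursuer_stays_when_together:
  assumes R: "reduced_solution I l x y" and I: "compact I" "I \<noteq> {}" "I \<subseteq> {0..1/4}"
    and l: "0 < l" "l \<le> 1/1024"
    and \<alpha>: "\<alpha> \<in> I" "x = (1 - l) * after_move w x y \<alpha>" and w: "w = chase_value l"
    and \<beta>: "\<beta> \<in> {0..1/4}"
  shows "x \<le> (1 - l) * after_move (after_move 0 w w \<beta>) (after_move 1 x y \<beta>) (after_move 1 y x \<beta>) \<alpha>"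
proof -
  note D = reduced_solutionD[OF R I(1,2)]
  have ord: "2 * w \<le> y" "x \<le> y" using reduced_solution_order[OF R I l] w by auto
  have wb: "0 \<le> w" "w \<le> 1/2" using chase_value_bounds[of l] l w by auto
  have a: "\<alpha> \<in> {0..1/4}" using \<alpha> I by auto
  note a2 = sq_le_quarter[OF a]
  define A where "A = after_move w x y \<alpha>"
  define B where "B = after_move w y x \<alpha>"
  define C where "C = 1 - \<alpha>\<^sup>2"
  have split: "after_move (after_move 0 w w \<beta>) (after_move 1 x y \<beta>) (after_move 1 y x \<beta>) \<alpha> = after_move C A B \<beta>"
    by (simp add: A_def B_def C_def after_move_def algebra_simps)
  have "B - A = (1 - 2 * \<alpha> - \<alpha>\<^sup>2) * (y - x)" by (simp add: A_def B_def after_move_def algebra_simps)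
  moreover have "0 \<le> (1 - 2 * \<alpha> - \<alpha>\<^sup>2) * (y - x)"
    using a a2 ord by (intro mult_nonneg_nonneg) auto
  ultimately have AB: "A \<le> B" by simp
  have AC: "A \<le> C"
  proof -
    \<comment> \<open>The continuation falls short of \<open>1\<close> by at least half the probability \<open>\<alpha>\<^sup>2\<close> of arriving at
      \<open>c\<close>, and so does \<open>x\<close>.\<close>
    have "(1 - \<alpha> - \<alpha>\<^sup>2) * x \<le> 1 - \<alpha> - \<alpha>\<^sup>2" "\<alpha> * y \<le> \<alpha>"
      using a a2 D(1,2) by (auto intro!: mult_left_le)
    moreover have aw: "\<alpha>\<^sup>2 * w \<le> \<alpha>\<^sup>2 * (1/2)" using wb by (intro mult_left_mono) auto
    ultimately have "A \<le> 1 - \<alpha>\<^sup>2 / 2" unfolding A_def after_move_def by simp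
    moreover have "(1 - l) * A \<le> A"
      unfolding A_def using after_move_bounds[OF a D(1,2), of w] wb l
      by (intro mult_left_le_one_le) auto
    then have "x \<le> A" using \<alpha>(2) unfolding A_def by linarith
    ultimately have x: "\<alpha>\<^sup>2 / 2 \<le> 1 - x" by simp
    have "\<alpha>\<^sup>2 * w \<le> \<alpha>\<^sup>2 * (11/32)"
      using chase_value_bounds(3)[of l] l w by (intro mult_left_mono) auto
    also have "\<dots> = (11/16) * (\<alpha>\<^sup>2 / 2)" by simp
    also have "\<dots> \<le> (11/16) * (1 - x)" using x by (intro mult_left_mono) auto
    also have "\<dots> \<le> (1 - \<alpha> - \<alpha>\<^sup>2) * (1 - x)"
      using a a2 D(1) by (intro mult_right_mono) auto
    finally have "\<alpha>\<^sup>2 * w \<le> (1 - \<alpha> - \<alpha>\<^sup>2) * (1 - x)" .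
    moreover have "0 \<le> \<alpha> * (1 - y)" using a D(2) by (intro mult_nonneg_nonneg) auto
    moreover have "C - A = ((1 - \<alpha> - \<alpha>\<^sup>2) * (1 - x) - \<alpha>\<^sup>2 * w) + \<alpha> * (1 - y)"
      by (simp add: A_def C_def after_move_def algebra_simps)
    ultimately have "0 \<le> C - A" by (metis add_nonneg_nonneg diff_ge_0_iff_ge)
    then show ?thesis by simp
  qed
  have "\<beta> * A \<le> \<beta> * B" "\<beta>\<^sup>2 * A \<le> \<beta>\<^sup>2 * C"
    using AB AC \<beta> by (auto intro!: mult_left_mono)
  then have "A \<le> after_move C A B \<beta>" by (simp add: after_move_def algebra_simps)
  then have "(1 - l) * A \<le> (1 - l) * after_move C A B \<beta>"
    using l by (intro mult_left_mono) auto
  then show ?thesis using \<alpha>(2) unfolding split A_def by linarith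
qed

text \<open>When the players are apart, a change of location by Player 1 brings them together with high
  probability, and \<open>c\<close> is worth at most \<open>chase_value l\<close>, which is small compared with \<open>y\<close>.\<close>

lemma evader_stays_when_apart:
  assumes R: "reduced_solution I l x y" and I: "compact I" "I \<noteq> {}" "I \<subseteq> {0..1/4}"
    and l: "0 < l" "l \<le> 1/1024" and w: "w = chase_value l"
    and \<beta>: "\<beta> \<in> {0..1/4}" "y = l + (1 - l) * after_move 1 y x \<beta>"
    and \<alpha>: "\<alpha> \<in> {0..1/4}"
  shows "l + (1 - l) * after_move (after_move 0 w w \<beta>) (after_move 1 y x \<beta>) (after_move 1 x y \<beta>) \<alpha> \<le> y"
proof -
  note D = reduced_solutionD[OF R I(1,2)]
  have ord: "2 * w \<le> y" "x \<le> y" using reduced_solution_order[OF R I l] w by auto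
  have wb: "0 \<le> w" "w \<le> 1/2" using chase_value_bounds[of l] l w by auto
  note b2 = sq_le_quarter[OF \<beta>(1)]
  define A where "A = after_move 1 y x \<beta>"
  define B where "B = after_move 1 x y \<beta>"
  define C where "C = (1 - \<beta>\<^sup>2) * w"
  have C: "after_move 0 w w \<beta> = C" by (simp add: C_def after_move_def algebra_simps)
  have "A - B = (1 - 2 * \<beta> - \<beta>\<^sup>2) * (y - x)" by (simp add: A_def B_def after_move_def algebra_simps)
  moreover have "0 \<le> (1 - 2 * \<beta> - \<beta>\<^sup>2) * (y - x)"
    using \<beta> b2 ord by (intro mult_nonneg_nonneg) auto
  ultimately have AB: "B \<le> A" by simp
  have AC: "C \<le> A"
  proof -
    have "(11/16) * (2 * w) \<le> (1 - \<beta> - \<beta>\<^sup>2) * y"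
      using \<beta> b2 ord wb by (intro mult_mono) auto
    moreover have "0 \<le> \<beta> * x" "0 \<le> \<beta>\<^sup>2" "0 \<le> \<beta>\<^sup>2 * w" using \<beta> D(1) wb by auto
    moreover have "A - C = (1 - \<beta> - \<beta>\<^sup>2) * y + \<beta> * x + \<beta>\<^sup>2 - w + \<beta>\<^sup>2 * w"
      by (simp add: A_def C_def after_move_def algebra_simps)
    ultimately show ?thesis using wb(1) by linarith
  qed
  have "\<alpha> * B \<le> \<alpha> * A" "\<alpha>\<^sup>2 * C \<le> \<alpha>\<^sup>2 * A"
    using AB AC \<alpha> by (auto intro!: mult_left_mono)
  then have "after_move C A B \<alpha> \<le> A" by (simp add: after_move_def algebra_simps)
  then have "(1 - l) * after_move C A B \<alpha> \<le> (1 - l) * A"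
    using l by (intro mult_left_mono) auto
  then show ?thesis using \<beta>(2) unfolding C A_def B_def by linarith
qed

lemma candidate_local_saddle:
  assumes R: "reduced_solution I l x y" and I: "compact I" "0 \<in> I" "I \<subseteq> {0..1/4}"
    and l: "0 < l" "l \<le> 1/1024"
  shows "\<exists>\<alpha> \<beta>. local_saddle I {0..1/4} l (candidate (chase_value l) x y) z z' \<alpha> \<beta>"
proof -
  define w where "w = chase_value l"
  have ne: "I \<noteq> {}" using I by auto
  note D = reduced_solutionD[OF R I(1) ne, folded w_def]
  have wb: "0 \<le> w" "w = l + (1 - l) * (15 / 16) * w"
    using chase_value_bounds[of l] l w_def by auto
  obtain \<alpha> where \<alpha>: "\<alpha> \<in> I" "x = (1 - l) * after_move w x y \<alpha>" using D(3) by blast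
  obtain \<beta> where \<beta>: "\<beta> \<in> {0..1/4}" "y = l + (1 - l) * after_move 1 y x \<beta>" using D(5) by blast
  note together = pursuer_stays_when_together[OF R I(1) ne I(3) l \<alpha> w_def]
  note apart = evader_stays_when_apart[OF R I(1) ne I(3) l w_def \<beta>]
  have apart': "l + (1 - l) * after_move (after_move 0 w w \<beta>) (after_move 1 y x \<beta>) (after_move 1 x y \<beta>) a \<le> y"
    if "a \<in> I" for a using apart that I by blast
  have chase: "w \<le> l + (1 - l) * after_move 0 w w b" if "b \<in> {0..1/4}" for b
  proof -
    have "(15/16) * w \<le> (1 - b\<^sup>2) * w"
      using sq_le_quarter[OF that] wb by (intro mult_right_mono) auto
    then have "(1 - l) * ((15/16) * w) \<le> (1 - l) * ((1 - b\<^sup>2) * w)"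
      using l by (intro mult_left_mono) auto
    then show ?thesis using wb(2) by (simp add: after_move_def algebra_simps)
  qed
  have chase': "l + (1 - l) * after_move 0 w w (1/4) = w"
    using wb(2) by (simp add: after_move_def power2_eq_square algebra_simps)
  have safe: "l + (1 - l) * after_move 0 1 1 a \<le> 1" for a
  proof -
    have "(1 - l) * (1 - a\<^sup>2) \<le> (1 - l) * 1" using l by (intro mult_left_mono) auto
    then show ?thesis by (simp add: after_move_def)
  qed
  note sim = local_saddle_def lin_ext_move payoff_def after_move_const after_move_0
  let ?s = "local_saddle I {0..1/4} l (candidate w x y)"
  have "?s loc_a loc_a \<alpha> 0" "?s loc_b loc_b \<alpha> 0"
    using together \<alpha> D(4) by (simp_all add: sim)
  moreover have "?s loc_a loc_b 0 \<beta>" "?s loc_b loc_a 0 \<beta>"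
    using apart' \<beta> D(6) I by (simp_all add: sim)
  moreover have "?s loc_c loc_a 0 (1/4)" "?s loc_c loc_b 0 (1/4)"
    using chase chase' I by (simp_all add: sim)
  moreover have "?s loc_a loc_c 0 0" "?s loc_b loc_c 0 0" "?s loc_c loc_c 0 0"
    using safe I by (simp_all add: sim)
  ultimately show ?thesis unfolding w_def by (cases z; cases z'; simp only:; blast)
qed

lemma disc_value_small_discount:
  assumes I: "compact I" "0 \<in> I" "I \<subseteq> {0..1/4}" and l: "0 < l" "l \<le> 1/1024"
  obtains x y where "reduced_solution I l x y"
    "disc_value I {0..1/4} l = candidate (chase_value l) x y"
proof -
  obtain x y where R: "reduced_solution I l x y"
    using reduced_solution_exists[of I l] assms by auto
  then have "disc_value I {0..1/4} l = candidate (chase_value l) x y"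
    using assms by (intro disc_value_eq_if_local_saddles candidate_local_saddle) auto
  with R show ?thesis using that by blast
qed

section \<open>Bounds for the values\<close>

text \<open>All estimates are in terms of \<open>r = sqrt (l / (1 - l))\<close>, which is the order of magnitude of
  optimal parameters. The bound on \<open>l\<close> makes \<open>r\<close> itself an admissible parameter of Player 2.\<close>

lemma discount_as_speed:
  fixes l :: real
  assumes "0 < l" "l \<le> 1/1024" and r: "r = sqrt (l / (1 - l))"
  shows "0 < r" "r \<le> 1/4" "r\<^sup>2 = l / (1 - l)" "l = r\<^sup>2 * (1 - l)"
proof -
  show "0 < r" using assms by simp
  show r2: "r\<^sup>2 = l / (1 - l)" using assms by simp
  then show "l = r\<^sup>2 * (1 - l)" using assms by simp
  have "l / (1 - l) \<le> (1/4)\<^sup>2" using assms by (simp add: field_simps power2_eq_square)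
  then show "r \<le> 1/4" unfolding r by (intro real_le_lsqrt) auto
qed

text \<open>The optimality equation of Player 2, for \<open>e = 1 - y\<close> and \<open>d = y - x\<close>, is
  \<open>r\<^sup>2 e = max {b d - b\<^sup>2 e | b}\<close>. The choice \<open>b = r\<close> gives \<open>d \<le> 2 r e\<close>; at the maximizer
  \<open>b d = (b\<^sup>2 + r\<^sup>2) e \<ge> 2 b r e\<close> gives the converse.\<close>

lemma separation_gain:
  assumes R: "reduced_solution I l x y" and I: "compact I" "I \<noteq> {}" "I \<subseteq> {0..1/4}"
    and l: "0 < l" "l \<le> 1/1024" and r: "r = sqrt (l / (1 - l))"
  shows "y - x = 2 * r * (1 - y)"
proof -
  note D = reduced_solutionD[OF R I(1,2)]
  note rb = discount_as_speed[OF l r]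
  define e d where "e = 1 - y" and "d = y - x"
  have ed: "0 \<le> e" "0 \<le> d"
    using D(2) reduced_solution_order[OF R I l] by (auto simp: e_def d_def)
  have scaled: "l + (1 - l) * after_move 1 y x b - y = (1 - l) * (r\<^sup>2 * e - (b * d - b\<^sup>2 * e))" for b
  proof -
    have "l + (1 - l) * after_move 1 y x b - y = l * e - (1 - l) * (b * d - b\<^sup>2 * e)"
      by (simp add: after_move_def e_def d_def algebra_simps)
    also have "l * e = (1 - l) * (r\<^sup>2 * e)" using rb(4) by (metis mult.assoc mult.commute)
    finally show ?thesis by (simp add: right_diff_distrib)
  qed
  have "0 \<le> (1 - l) * (r\<^sup>2 * e - (r * d - r\<^sup>2 * e))"
    using D(6)[of r] scaled[of r] rb by auto
  then have "r * d \<le> r * (2 * r * e)"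
    using l by (simp add: zero_le_mult_iff power2_eq_square mult_ac)
  then have upper: "d \<le> 2 * r * e" using rb(1) mult_le_cancel_left_pos by blast
  obtain b where b: "b \<in> {0..1/4}" "y = l + (1 - l) * after_move 1 y x b" using D(5) by blast
  then have "(1 - l) * (r\<^sup>2 * e - (b * d - b\<^sup>2 * e)) = 0" using scaled[of b] by simp
  then have "r\<^sup>2 * e = b * d - b\<^sup>2 * e" using l by simp
  then have eq: "b * d = (b\<^sup>2 + r\<^sup>2) * e" by algebra
  have lower: "2 * r * e \<le> d"
  proof (cases "b = 0")
    case True
    with eq have "r\<^sup>2 * e = 0" by simp
    then have "e = 0" using rb(1) by simp
    with ed show ?thesis by simp
  next
    case False
    have "2 * b * r * e \<le> (b\<^sup>2 + r\<^sup>2) * e"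
      using ed sum_squares_bound[of b r] by (intro mult_right_mono) auto
    then have "b * (2 * r * e) \<le> b * d" using eq by (simp add: mult_ac)
    then show ?thesis using False b(1) by simp
  qed
  from upper lower show ?thesis by (simp add: e_def d_def)
qed

lemma separation_gain_scaled:
  assumes "y - x = 2 * r * (1 - y)"
  shows "(1 + 2 * r) * (y - x) = 2 * r * (1 - (x::real))"
  using assms by algebra

lemma after_move_scaled:
  fixes l :: real
  assumes "l = r\<^sup>2 * (1 - l)"
  shows "x - (1 - l) * after_move w x y a = (1 - l) * (r\<^sup>2 * x - (a * (y - x) - a\<^sup>2 * (x - w)))"
proof -
  have "x - (1 - l) * after_move w x y a = l * x - (1 - l) * (a * (y - x) - a\<^sup>2 * (x - w))"
    by (simp add: after_move_def algebra_simps)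
  also have "l * x = (1 - l) * (r\<^sup>2 * x)" using assms by (metis mult.assoc mult.commute)
  finally show ?thesis by (simp add: right_diff_distrib)
qed

text \<open>Since the parameter \<open>r\<close> cannot improve on \<open>x\<close>, one has \<open>r d - r\<^sup>2 (x - w) \<le> r\<^sup>2 x\<close> with
  \<open>d = y - x\<close>, and \<open>w \<ge> 0\<close> leaves \<open>d \<le> 2 r x\<close>. The value of \<open>d\<close> from \<open>separation_gain\<close> turns
  this into a lower bound for \<open>x\<close>.\<close>

lemma value_lower_bound:
  assumes R: "reduced_solution I l x y" and I: "compact I" "I \<noteq> {}" "I \<subseteq> {0..1/4}"
    and l: "0 < l" "l \<le> 1/1024" and r: "r = sqrt (l / (1 - l))" and "r \<in> I"
  shows "1 / (2 + 2 * r) \<le> x"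
proof -
  note D = reduced_solutionD[OF R I(1,2)]
  note rb = discount_as_speed[OF l r]
  define d where "d = y - x"
  have w: "0 \<le> chase_value l" using chase_value_bounds l by simp
  have "0 \<le> (1 - l) * (r\<^sup>2 * x - (r * d - r\<^sup>2 * (x - chase_value l)))"
    using D(4)[OF \<open>r \<in> I\<close>] after_move_scaled[OF rb(4), of x "chase_value l" y r] d_def by simp
  then have "r * d - r\<^sup>2 * (x - chase_value l) \<le> r\<^sup>2 * x"
    using l by (simp add: zero_le_mult_iff)
  moreover have "0 \<le> r\<^sup>2 * chase_value l" using w by simp
  ultimately have "r * d \<le> r * (2 * r * x)"
    by (simp add: power2_eq_square algebra_simps)
  then have "d \<le> 2 * r * x" using rb(1) mult_le_cancel_left_pos by blast
  then have "(1 + 2 * r) * d \<le> (1 + 2 * r) * (2 * r * x)"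
    using rb by (intro mult_left_mono) auto
  then have "2 * r * (1 - x) \<le> 2 * r * ((1 + 2 * r) * x)"
    using separation_gain_scaled[OF separation_gain[OF R I l r]] unfolding d_def by (simp add: mult_ac)
  then have "1 - x \<le> (1 + 2 * r) * x" using rb(1) by simp
  then show ?thesis using rb(1) by (simp add: field_simps)
qed

text \<open>At the optimal \<open>a\<close> of Player 1, \<open>(a\<^sup>2 + r\<^sup>2) x = a (d + a w)\<close> with \<open>d = y - x\<close>. The
  hypothesis, in which \<open>c\<close> measures how far \<open>I\<close> stays away from \<open>r\<close> (\<open>c = 2\<close> is always
  possible), turns this into \<open>c r x \<le> d + a w\<close>, where \<open>d\<close> is given by \<open>separation_gain\<close> and \<open>w\<close> is of
  order \<open>r\<^sup>2\<close>.\<close>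

lemma value_upper_bound:
  assumes R: "reduced_solution I l x y" and I: "compact I" "I \<noteq> {}" "I \<subseteq> {0..1/4}"
    and l: "0 < l" "l \<le> 1/1024" and r: "r = sqrt (l / (1 - l))"
    and c: "\<And>a. a \<in> I \<Longrightarrow> c * r * a \<le> a\<^sup>2 + r\<^sup>2"
  shows "c * x \<le> 2 * (1 - x) + 4 * r"
proof -
  note D = reduced_solutionD[OF R I(1,2)]
  note rb = discount_as_speed[OF l r]
  define d w where "d = y - x" and "w = chase_value l"
  have w: "0 \<le> w" "w \<le> 16 * r\<^sup>2" using chase_value_bounds[of l] l rb(3) by (auto simp: w_def)
  have gap: "d = 2 * r * (1 - y)" "0 \<le> d"
    using separation_gain[OF R I l r] reduced_solution_order[OF R I l] by (auto simp: d_def)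
  obtain a where a: "a \<in> I" "x = (1 - l) * after_move w x y a" using D(3) w_def by blast
  have "(1 - l) * (r\<^sup>2 * x - (a * d - a\<^sup>2 * (x - w))) = 0"
    using a(2) after_move_scaled[OF rb(4), of x w y a] d_def by simp
  then have "r\<^sup>2 * x = a * d - a\<^sup>2 * (x - w)" using l by simp
  then have eq: "(a\<^sup>2 + r\<^sup>2) * x = a * (d + a * w)" by algebra
  show ?thesis
  proof (cases "a = 0")
    case True
    with eq rb(1) have "x = 0" by simp
    with rb(1) show ?thesis by simp
  next
    case False
    then have a0: "0 < a" "a \<le> 1/4" using a(1) I(3) by auto
    have "c * r * a * x \<le> (a\<^sup>2 + r\<^sup>2) * x" using c[OF a(1)] D(1) by (intro mult_right_mono) auto
    then have "a * (c * r * x) \<le> a * (d + a * w)" unfolding eq by (simp add: mult_ac)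
    then have "c * r * x \<le> d + a * w" using a0 by simp
    also have "a * w \<le> (1/4) * (16 * r\<^sup>2)" using a0 w by (intro mult_mono) auto
    also have "d \<le> 2 * r * (1 - x)"
      using gap rb(1) by (simp add: d_def)
    finally have "r * (c * x) \<le> r * (2 * (1 - x) + 4 * r)"
      by (simp add: power2_eq_square algebra_simps)
    then show ?thesis using rb(1) by simp
  qed
qed

section \<open>Convergence\<close>

lemma tendsto_speed: "((\<lambda>l. sqrt (l / (1 - l))) \<longlongrightarrow> 0) (at_right (0::real))"
proof -
  have "((\<lambda>l. sqrt (l / (1 - l))) \<longlongrightarrow> sqrt (0 / (1 - 0))) (at_right (0::real))"
    by (intro tendsto_intros) auto
  then show ?thesis by simp
qed

lemma eventually_small_discount: "\<forall>\<^sub>F l in at_right 0. 0 < l \<and> l \<le> (1/1024 :: real)"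
  unfolding eventually_at_right_field by (intro exI[of _ "1/1024"]) auto

text \<open>Bounds on \<open>x\<close> alone suffice, since \<open>x \<le> y \<le> x + 2 r\<close> and the remaining values have limits that
  do not depend on \<open>I\<close>.\<close>

lemma tendsto_disc_value:
  assumes I: "compact I" "0 \<in> I" "I \<subseteq> {0..1/4}"
    and lo: "(lo \<longlongrightarrow> c) (at_right 0)" and hi: "(hi \<longlongrightarrow> c) (at_right 0)"
    and bounds: "\<And>l x y. reduced_solution I l x y \<Longrightarrow> 0 < l \<Longrightarrow> l \<le> 1/1024 \<Longrightarrow> lo l \<le> x \<and> x \<le> hi l"
  shows "((\<lambda>l. disc_value I {0..1/4} l z z') \<longlongrightarrow> limit_fun c z z') (at_right 0)"
proof -
  let ?r = "\<lambda>l. sqrt (l / (1 - l))"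
  let ?V = "disc_value I {0..1/4}"
  have ev: "\<forall>\<^sub>F l in at_right 0. Q l (?V l)"
    if "\<And>l x y. reduced_solution I l x y \<Longrightarrow> 0 < l \<Longrightarrow> l \<le> 1/1024 \<Longrightarrow> Q l (candidate (chase_value l) x y)"
    for Q
    using eventually_small_discount
    by eventually_elim (metis disc_value_small_discount[OF I] that)
  have same: "((\<lambda>l. ?V l z z) \<longlongrightarrow> c) (at_right 0)" if "z \<noteq> loc_c" for z
    using that bounds by (intro tendsto_sandwich[OF _ _ lo hi] ev; cases z; simp)
  have "((\<lambda>l. hi l + 2 * ?r l) \<longlongrightarrow> c + 2 * 0) (at_right 0)"
    by (intro tendsto_intros hi tendsto_speed)
  then have hi': "((\<lambda>l. hi l + 2 * ?r l) \<longlongrightarrow> c) (at_right 0)" by simp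
  have "lo l \<le> y \<and> y \<le> hi l + 2 * ?r l" if R: "reduced_solution I l x y" and l: "0 < l" "l \<le> 1/1024" for l x y
  proof -
    have ne: "I \<noteq> {}" using I by auto
    have "?r l * (1 - y) \<le> ?r l"
      using discount_as_speed[OF l refl] reduced_solutionD(2)[OF R I(1) ne]
      by (intro mult_left_le) auto
    then show ?thesis
      using bounds[OF R l] separation_gain[OF R I(1) ne I(3) l refl] reduced_solution_order[OF R I(1) ne I(3) l]
      by auto
  qed
  then have apart: "((\<lambda>l. ?V l z z') \<longlongrightarrow> c) (at_right 0)" if "z \<noteq> z'" "z \<noteq> loc_c" "z' \<noteq> loc_c" for z z'
    using that by (intro tendsto_sandwich[OF _ _ lo hi'] ev; cases z; cases z'; simp)
  have "(chase_value \<longlongrightarrow> 16 * 0 / (1 + 15 * 0)) (at_right 0)"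
    unfolding chase_value_def by (intro tendsto_intros) auto
  then have "(chase_value \<longlongrightarrow> 0) (at_right 0)" by simp
  moreover have "\<forall>\<^sub>F l in at_right 0. chase_value l = ?V l loc_c z" if "z \<noteq> loc_c" for z
    using that by (intro ev) (cases z; simp)
  ultimately have chase: "((\<lambda>l. ?V l loc_c z) \<longlongrightarrow> 0) (at_right 0)" if "z \<noteq> loc_c" for z
    using that by (blast intro: Lim_transform_eventually)
  have const: "((\<lambda>l. ?V l z loc_c) \<longlongrightarrow> (if z = loc_c then 0 else 1)) (at_right 0)" for z
  proof (rule tendsto_eventually)
    show "\<forall>\<^sub>F l in at_right 0. ?V l z loc_c = (if z = loc_c then 0 else 1)"
      by (intro ev) (cases z; simp)
  qed
  show ?thesis
    using same[of z] apart[of z z'] chase[of z'] const[of z] by (cases z; cases z'; simp)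
qed

lemma disc_value_interval_limit:
  "((\<lambda>l. disc_value {0..1/4} {0..1/4} l z z') \<longlongrightarrow> limit_fun (1/2) z z') (at_right 0)"
proof (rule tendsto_disc_value)
  let ?r = "\<lambda>l::real. sqrt (l / (1 - l))"
  have "((\<lambda>l. 1 / (2 + 2 * ?r l)) \<longlongrightarrow> 1 / (2 + 2 * 0)) (at_right 0)"
    by (intro tendsto_intros tendsto_speed) auto
  then show "((\<lambda>l. 1 / (2 + 2 * ?r l)) \<longlongrightarrow> 1 / 2) (at_right 0)" by simp
  have "((\<lambda>l. 1 / 2 + ?r l) \<longlongrightarrow> 1 / 2 + 0) (at_right 0)"
    by (intro tendsto_intros tendsto_speed)
  then show "((\<lambda>l. 1 / 2 + ?r l) \<longlongrightarrow> 1 / 2) (at_right 0)" by simp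
  fix l x y :: real
  assume R: "reduced_solution {0..1/4} l x y" and l: "0 < l" "l \<le> 1/1024"
  have "2 * x \<le> 2 * (1 - x) + 4 * ?r l"
    by (rule value_upper_bound[OF R _ _ _ l refl])
      (auto simp: add.commute mult_ac intro: order_trans[OF _ sum_squares_bound])
  moreover have "1 / (2 + 2 * ?r l) \<le> x"
    using discount_as_speed[OF l refl] by (intro value_lower_bound[OF R _ _ _ l refl]) auto
  ultimately show "1 / (2 + 2 * ?r l) \<le> x \<and> x \<le> 1 / 2 + ?r l" by simp
qed auto

text \<open>The parameter \<open>1/4\<close> is far from \<open>r\<close>: \<open>a\<^sup>2 \<ge> a / 4\<close> allows \<open>c = 1 / (4 r)\<close> in
  \<open>value_upper_bound\<close>.\<close>

lemma disc_value_two_point_limit: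
  "((\<lambda>l. disc_value {0, 1/4} {0..1/4} l z z') \<longlongrightarrow> limit_fun 0 z z') (at_right 0)"
proof (rule tendsto_disc_value)
  let ?r = "\<lambda>l::real. sqrt (l / (1 - l))"
  show "((\<lambda>l. 0) \<longlongrightarrow> (0::real)) (at_right (0::real))" by simp
  have "((\<lambda>l. 12 * ?r l) \<longlongrightarrow> 12 * 0) (at_right 0)"
    by (intro tendsto_intros tendsto_speed)
  then show "((\<lambda>l. 12 * ?r l) \<longlongrightarrow> 0) (at_right 0)" by simp
  fix l x y :: real
  assume R: "reduced_solution {0, 1/4} l x y" and l: "0 < l" "l \<le> 1/1024"
  note rb = discount_as_speed[OF l refl]
  have x: "x \<in> {0..1}" using reduced_solutionD(1)[OF R] by simp
  have "1 / (4 * ?r l) * ?r l * a \<le> a\<^sup>2 + (?r l)\<^sup>2" if "a \<in> {0, 1/4}" for a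
  proof -
    have "1 / (4 * ?r l) * ?r l = 1 / 4" using rb(1) l by simp
    moreover have "1 / 4 * a \<le> a\<^sup>2" using that by (auto simp: power2_eq_square)
    moreover have "0 \<le> (?r l)\<^sup>2" by (rule zero_le_power2)
    ultimately show ?thesis by (metis add_increasing2)
  qed
  then have "1 / (4 * ?r l) * x \<le> 2 * (1 - x) + 4 * ?r l"
    by (intro value_upper_bound[OF R _ _ _ l refl]) auto
  also have "\<dots> \<le> 3" using x rb by auto
  finally have "x \<le> 12 * ?r l" using rb(1) by (simp add: field_simps)
  with x show "0 \<le> x \<and> x \<le> 12 * ?r l" by simp
qed auto

section \<open>Oscillation for a sparse parameter set\<close>

abbreviation sparse :: "real set" where
  "sparse \<equiv> {(1/4) ^ n | n :: nat. n \<ge> 1} \<union> {0}"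

lemma sparse_set: "compact sparse" "0 \<in> sparse" "sparse \<subseteq> {0..1/4}"
proof -
  have "(\<lambda>n. (1/4::real) ^ Suc n) \<longlonglongrightarrow> 0"
    by (intro LIMSEQ_Suc LIMSEQ_power_zero) simp
  from compact_sequence_with_limit[OF this]
  have "compact (insert 0 (range (\<lambda>n. (1/4::real) ^ Suc n)))" .
  also have "insert 0 (range (\<lambda>n. (1/4::real) ^ Suc n)) = sparse"
  proof -
    have "{(1/4::real) ^ n | n :: nat. n \<ge> 1} = range (\<lambda>n. (1/4) ^ Suc n)"
    proof safe
      fix n :: nat assume "1 \<le> n"
      then show "(1/4::real) ^ n \<in> range (\<lambda>n. (1/4) ^ Suc n)"
        by (intro image_eqI[of _ _ "n - 1"]) auto
    next
      fix n show "\<exists>m. (1/4::real) ^ Suc n = (1/4) ^ m \<and> 1 \<le> m" by (intro exI[of _ "Suc n"]) simp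
    qed
    then show ?thesis by simp
  qed
  finally show "compact sparse" .
  have "(1/4::real) ^ n \<le> 1/4" if "n \<ge> 1" for n
    using power_decreasing[OF that, of "1/4::real"] by simp
  then show "sparse \<subseteq> {0..1/4}" by auto
qed simp

text \<open>With \<open>k = a / r\<close> this is \<open>k\<^sup>2 - (5/2) k + 1 \<ge> 0\<close>, whose roots are \<open>1/2\<close> and \<open>2\<close>. Consecutive
  powers have ratio \<open>4\<close>, and \<open>r\<close> is the geometric mean of two of them, so no \<open>k\<close> lies strictly between
  the roots.\<close>

lemma sparse_avoids_doubles:
  assumes "a \<in> sparse" and r: "r = 2 * (1/4) ^ m"
  shows "(5/2) * r * a \<le> a\<^sup>2 + r\<^sup>2"
proof -
  have "0 \<le> (2 * a - r) * (a - 2 * r)"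
  proof (cases "a = 0")
    case False
    then obtain n where a: "a = (1/4) ^ n" using assms by auto
    have p: "0 < (1/4::real) ^ m" by simp
    show ?thesis
    proof (cases "m \<le> n")
      case True
      then have "a \<le> (1/4) ^ m" unfolding a by (intro power_decreasing) auto
      with p have "2 * a - r \<le> 0" "a - 2 * r \<le> 0" unfolding r by linarith+
      then show ?thesis by (rule mult_nonpos_nonpos)
    next
      case False
      then have "(1/4::real) ^ m \<le> (1/4) ^ Suc n" by (intro power_decreasing) auto
      then have "4 * (1/4) ^ m \<le> a" unfolding a by simp
      with p have "0 \<le> 2 * a - r" "0 \<le> a - 2 * r" unfolding r by linarith+
      then show ?thesis by (rule mult_nonneg_nonneg)
    qed
  qed simp
  then show ?thesis by (simp add: power2_eq_square algebra_simps)
qed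

text \<open>The inverse of \<open>l \<mapsto> sqrt (l / (1 - l))\<close>.\<close>

definition discount_at :: "real \<Rightarrow> real" where
  "discount_at r = r\<^sup>2 / (1 + r\<^sup>2)"

lemma sqrt_discount_at: "0 \<le> r \<Longrightarrow> sqrt (discount_at r / (1 - discount_at r)) = r"
proof -
  assume "0 \<le> r"
  have "1 + r\<^sup>2 > 0" by (simp add: add_pos_nonneg)
  then have "discount_at r / (1 - discount_at r) = r\<^sup>2"
    unfolding discount_at_def by (simp add: field_simps)
  with \<open>0 \<le> r\<close> show ?thesis by simp
qed

lemma discount_at_to_0:
  assumes "s \<longlonglongrightarrow> 0" "\<And>n. 0 < s n"
  shows "filterlim (\<lambda>n. discount_at (s n)) (at_right 0) sequentially"
proof -
  have "(\<lambda>n. discount_at (s n)) \<longlonglongrightarrow> 0\<^sup>2 / (1 + 0\<^sup>2)"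
    unfolding discount_at_def by (intro tendsto_intros assms) auto
  moreover have "0 < discount_at (s n)" for n
    using assms(2)[of n] by (simp add: discount_at_def add_pos_nonneg)
  ultimately show ?thesis by (intro tendsto_imp_filterlim_at_right) auto
qed

text \<open>A limit would be at least \<open>1/2\<close> along \<open>r = (1/4)\<^sup>n\<close> by \<open>value_lower_bound\<close>, and at most the
  solution \<open>4/9\<close> of \<open>(5/2) x = 2 (1 - x)\<close> along \<open>r = 2 (1/4)\<^sup>n\<close> by \<open>value_upper_bound\<close>.\<close>

lemma disc_value_sparse_no_limit:
  "\<not> ((\<lambda>l. disc_value sparse {0..1/4} l loc_a loc_a) \<longlongrightarrow> c) (at_right 0)"
proof
  assume lim: "((\<lambda>l. disc_value sparse {0..1/4} l loc_a loc_a) \<longlongrightarrow> c) (at_right 0)"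
  let ?V = "\<lambda>r. disc_value sparse {0..1/4} (discount_at r) loc_a loc_a"
  have ne: "sparse \<noteq> {}" by simp
  have along: "(\<lambda>n. ?V (s n)) \<longlonglongrightarrow> c"
    and small: "\<forall>\<^sub>F n in sequentially. 0 < discount_at (s n) \<and> discount_at (s n) \<le> 1/1024"
    if "s \<longlonglongrightarrow> 0" "\<And>n. 0 < s n" for s
    using filterlim_compose[OF lim discount_at_to_0[OF that]]
      filterlim_iff[THEN iffD1, OF discount_at_to_0[OF that]] eventually_small_discount by blast+
  have pow: "(\<lambda>n. (1/4::real) ^ n) \<longlonglongrightarrow> 0" by (intro LIMSEQ_power_zero) simp
  define s t where "s n = (1/4::real) ^ Suc n" and "t n = 2 * (1/4::real) ^ n" for n
  have "s \<longlonglongrightarrow> 0" unfolding s_def using pow by (rule LIMSEQ_Suc)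
  have "t \<longlonglongrightarrow> 0" unfolding t_def using tendsto_mult_left[OF pow, of 2] by simp
  have pos: "0 < s n" "0 < t n" for n by (simp_all add: s_def t_def)
  have "\<forall>\<^sub>F n in sequentially. 1 / (2 + 2 * s n) \<le> ?V (s n)"
    using small[OF \<open>s \<longlonglongrightarrow> 0\<close> pos(1)]
  proof eventually_elim
    case (elim n)
    then obtain x y where R: "reduced_solution sparse (discount_at (s n)) x y"
      and V: "disc_value sparse {0..1/4} (discount_at (s n)) = candidate (chase_value (discount_at (s n))) x y"
      using disc_value_small_discount[OF sparse_set] by blast
    have "s n \<in> sparse" unfolding s_def by (auto intro!: exI[of _ "Suc n"])
    then show ?case
      using value_lower_bound[OF R sparse_set(1) ne sparse_set(3), of "s n"] elim
        sqrt_discount_at[of "s n"] pos(1)[of n] V by simp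
  qed
  moreover have "(\<lambda>n. 1 / (2 + 2 * s n)) \<longlonglongrightarrow> 1 / (2 + 2 * 0)"
    by (intro tendsto_intros \<open>s \<longlonglongrightarrow> 0\<close>) auto
  ultimately have "1 / (2 + 2 * 0) \<le> c"
    using along[OF \<open>s \<longlonglongrightarrow> 0\<close> pos(1)] by (intro tendsto_le[OF sequentially_bot])
  have "\<forall>\<^sub>F n in sequentially. ?V (t n) \<le> 4/9 + t n"
    using small[OF \<open>t \<longlonglongrightarrow> 0\<close> pos(2)]
  proof eventually_elim
    case (elim n)
    then obtain x y where R: "reduced_solution sparse (discount_at (t n)) x y"
      and V: "disc_value sparse {0..1/4} (discount_at (t n)) = candidate (chase_value (discount_at (t n))) x y"
      using disc_value_small_discount[OF sparse_set] by blast
    have "(5/2) * x \<le> 2 * (1 - x) + 4 * t n"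
      using elim pos(2)[of n] sqrt_discount_at[of "t n"]
      by (intro value_upper_bound[OF R sparse_set(1) ne sparse_set(3)] sparse_avoids_doubles)
        (auto simp: t_def)
    then show ?case using V pos(2)[of n] by simp
  qed
  moreover have "(\<lambda>n. 4/9 + t n) \<longlonglongrightarrow> 4/9 + 0"
    by (intro tendsto_intros \<open>t \<longlonglongrightarrow> 0\<close>)
  ultimately have "c \<le> 4/9 + 0"
    using along[OF \<open>t \<longlonglongrightarrow> 0\<close> pos(2)] by (intro tendsto_le[OF sequentially_bot])
  with \<open>1 / (2 + 2 * 0) \<le> c\<close> show False by simp
qed

theorem theorem6p2:
  "(\<forall>x y. ((\<lambda>l. disc_value {0..1/4} {0..1/4} l x y) \<longlongrightarrow> limit_fun (1/2) x y) (at_right 0)) \<and>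
   (\<forall>x y. ((\<lambda>l. disc_value {0, 1/4} {0..1/4} l x y) \<longlongrightarrow> limit_fun 0 x y) (at_right 0)) \<and>
   \<not> (\<exists>v. \<forall>x y.
        ((\<lambda>l. disc_value ({(1/4) ^ n | n :: nat. n \<ge> 1} \<union> {0}) {0..1/4} l x y)
          \<longlongrightarrow> v x y) (at_right 0))"
  using disc_value_interval_limit disc_value_two_point_limit disc_value_sparse_no_limit by blast

end
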